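(* (a) There exists a sequence $(\mu_k)$ of probability measures on $\mathbb R$, each a mixture of two Gaussian measures of variance $1$, such that $\delta(\mu_k)\to 0$ and \[ \lim_{k\to\infty}\inf_{m\in\mathbb R}\mathrm W_1(\mu_k,\gamma_{m,1})=+\infty. \] (b) There exist dimensions $n(k)\uparrow+\infty$ and probability measures $\mu_k$ on $\mathbb R^{n(k)}$, each isotropic (mean zero, covariance $\mathrm{Id}_{n(k)}$), such that $\delta(\mu_k)=O(n(k)^{-1/3})$ and \[ \inf_{m\in\mathbb R^{n(k)}}\mathrm W_2(\mu_k,\gamma_{m,\mathrm{Id}})=\Omega(n(k)^{1/6}). \]
   Context: $\gamma_{m,\mathrm{Id}}$ denotes the Gaussian measure on $\mathbb R^n$ with mean $m$ and identity covariance; in dimension one $\gamma_{m,1}$ is the Gaussian with mean $m$ and variance $1$. For $\mu$ with density $f=d\mu/d\gamma$ with respect to the standard Gaussian $\gamma$, $\delta(\mu)=\frac12\int|\nabla\log f|^2d\mu-\int\log f\,d\mu$ is the log-Sobolev deficit. $\mathrm W_p(\mu,\nu)=\inf \mathbb E[|X-Y|^p]^{1/p}$, the infimum over all couplings $(X,Y)$ of $(\mu,\nu)$. *)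

theory Defs
  imports "HOL-Probability.Probability"
begin

definition gauss1 :: "real \<Rightarrow> real measure" where
  "gauss1 m = density lborel (\<lambda>x. ennreal (normal_density m 1 x))"

text \<open>R^n is represented by functions nat => real, extensional on {..<n},
  with the product sigma-algebra (PiM).  Gaussian with mean m and identity covariance.\<close>
definition gaussn :: "nat \<Rightarrow> (nat \<Rightarrow> real) \<Rightarrow> (nat \<Rightarrow> real) measure" where
  "gaussn n m = PiM {..<n} (\<lambda>i. gauss1 (m i))"

definition euclid_dist :: "nat \<Rightarrow> (nat \<Rightarrow> real) \<Rightarrow> (nat \<Rightarrow> real) \<Rightarrow> real" where
  "euclid_dist n x y = sqrt (\<Sum>i<n. (x i - y i)^2)"

definition couplings :: "'a measure \<Rightarrow> 'b measure \<Rightarrow> ('a \<times> 'b) measure set" where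
  "couplings M N = {\<pi>. prob_space \<pi> \<and> sets \<pi> = sets (M \<Otimes>\<^sub>M N)
      \<and> distr \<pi> M fst = M \<and> distr \<pi> N snd = N}"

definition wasserstein :: "('a \<Rightarrow> 'a \<Rightarrow> real) \<Rightarrow> real \<Rightarrow> 'a measure \<Rightarrow> 'a measure \<Rightarrow> ennreal" where
  "wasserstein d p M N =
     (let c = (INF \<pi>\<in>couplings M N. \<integral>\<^sup>+ z. ennreal (d (fst z) (snd z) powr p) \<partial>\<pi>)
      in if c = \<infinity> then \<infinity> else ennreal (enn2real c powr (1 / p)))"

definition ls_deficit1 :: "real measure \<Rightarrow> real \<Rightarrow> bool" where
  "ls_deficit1 \<mu> D \<longleftrightarrow> (\<exists>f :: real \<Rightarrow> real.
      (\<forall>x. f x > 0) \<and> (\<forall>x. f differentiable (at x)) \<and>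
      \<mu> = density (gauss1 0) (\<lambda>x. ennreal (f x)) \<and>
      integrable \<mu> (\<lambda>x. (deriv (\<lambda>y. ln (f y)) x)^2) \<and>
      integrable \<mu> (\<lambda>x. ln (f x)) \<and>
      D = (1/2) * (\<integral>x. (deriv (\<lambda>y. ln (f y)) x)^2 \<partial>\<mu>) - (\<integral>x. ln (f x) \<partial>\<mu>))"

definition grad_sq :: "nat \<Rightarrow> ((nat \<Rightarrow> real) \<Rightarrow> real) \<Rightarrow> (nat \<Rightarrow> real) \<Rightarrow> real" where
  "grad_sq n g x = (\<Sum>i<n. (deriv (\<lambda>t. g (x(i := t))) (x i))^2)"

definition ls_deficitn :: "nat \<Rightarrow> (nat \<Rightarrow> real) measure \<Rightarrow> real \<Rightarrow> bool" where
  "ls_deficitn n \<mu> D \<longleftrightarrow> (\<exists>f :: (nat \<Rightarrow> real) \<Rightarrow> real.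
      (\<forall>x\<in>space (gaussn n (\<lambda>_. 0)). f x > 0 \<and>
          (\<forall>i<n. (\<lambda>t. f (x(i := t))) differentiable (at (x i)))) \<and>
      \<mu> = density (gaussn n (\<lambda>_. 0)) (\<lambda>x. ennreal (f x)) \<and>
      integrable \<mu> (grad_sq n (\<lambda>y. ln (f y))) \<and>
      integrable \<mu> (\<lambda>x. ln (f x)) \<and>
      D = (1/2) * (\<integral>x. grad_sq n (\<lambda>y. ln (f y)) x \<partial>\<mu>) - (\<integral>x. ln (f x) \<partial>\<mu>))"

definition gauss_mixture2 :: "real measure \<Rightarrow> bool" where
  "gauss_mixture2 \<mu> \<longleftrightarrow> (\<exists>p a b. 0 \<le> p \<and> p \<le> 1 \<and>
      \<mu> = density lborel (\<lambda>x. ennreal (p * normal_density a 1 x + (1 - p) * normal_density b 1 x)))"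

definition isotropic :: "nat \<Rightarrow> (nat \<Rightarrow> real) measure \<Rightarrow> bool" where
  "isotropic n \<mu> \<longleftrightarrow> prob_space \<mu> \<and> sets \<mu> = sets (gaussn n (\<lambda>_. 0)) \<and>
     (\<forall>i<n. \<forall>j<n. integrable \<mu> (\<lambda>x. x i * x j)) \<and>
     (\<forall>i<n. integrable \<mu> (\<lambda>x. x i) \<and> (\<integral>x. x i \<partial>\<mu>) = 0) \<and>
     (\<forall>i<n. \<forall>j<n. (\<integral>x. x i * x j \<partial>\<mu>) = (if i = j then 1 else 0))"

end

theory Submission
  imports Defs "HOL-Real_Asymp.Real_Asymp"
begin

text \<open>If \<open>\<mu>\<close> is the mixture of \<open>\<mu>0\<close> and \<open>\<mu>1\<close> with weights \<open>1 - p\<close> and \<open>p\<close>, then convexity of the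
  Fisher information and almost-concavity of the relative entropy bound the deficit of \<open>\<mu>\<close> by the average of the
  deficits of the components plus the Shannon entropy of \<open>(1 - p, p)\<close>. A component of tiny mass
  that is far away costs almost no deficit but dominates the transport cost.

  In (a) the components are the unit Gaussians with means \<open>0\<close> and \<open>a\<close>, where \<open>p\<close> tends to \<open>0\<close> and
  \<open>p a\<close> to infinity; \<open>\<integral>\<bar>x - m\<bar> d\<mu> \<ge> p a\<close> while \<open>\<integral>\<bar>x - m\<bar> d\<gamma>\<^sub>m \<le> 1\<close>. A lower bound on the deficit
  is also needed: \<open>\<integral> ln f d\<mu>\<close> is at most the average entropy of the components, and the loss of Fisher
  information in the mixture is exponentially small in \<open>a\<^sup>2\<close>.

  In (b), with \<open>n = N\<^sup>3\<close>, the components are centred Gaussians with covariances \<open>v Id\<close> and \<open>N\<^sup>4 Id\<close>, where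
  \<open>p = 1 / N\<^sup>6\<close> and \<open>v = 1 - N\<^sup>-\<^sup>2 + \<dots>\<close> is chosen to make the mixture isotropic. The large component
  contributes \<open>n p N\<^sup>4 = N\<close> to the second moment, essentially all of which has to be transported,
  while the deficit of the first component is of order \<open>n (1 - v)\<^sup>2 = 1 / N\<close>.\<close>

section \<open>Two-component mixtures\<close>

lemma has_bochner_integral_prob_const:
  fixes c :: real
  assumes "prob_space M"
  shows "has_bochner_integral M (\<lambda>_. c) c"
proof -
  interpret prob_space M by fact
  show ?thesis by (simp add: has_bochner_integral_iff prob_space)
qed

lemma has_bochner_integral_density_iff:
  fixes h g :: "'a \<Rightarrow> real"
  assumes "h \<in> borel_measurable M" "g \<in> borel_measurable M" "\<And>x. 0 < g x"
  shows "has_bochner_integral (density M g) h a \<longleftrightarrow> has_bochner_integral M (\<lambda>x. g x * h x) a"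
  using assms integrable_density[of h M g] integral_density[of h M g]
  by (auto simp: has_bochner_integral_iff less_imp_le)

text \<open>Both uses take the standard Gaussian for \<open>M\<close>, so that \<open>mix\<close> is
  the relative density that enters the deficit. Positivity is required at every point and not just
  almost everywhere, because the deficit predicates demand it pointwise and logarithms are taken
  throughout.\<close>

locale density_mixture =
  fixes M :: "'a measure" and f0 f1 :: "'a \<Rightarrow> real" and p :: real
  assumes p_pos: "0 < p" and p_less: "p < 1"
    and f0_measurable [measurable]: "f0 \<in> borel_measurable M"
    and f1_measurable [measurable]: "f1 \<in> borel_measurable M"
    and f0_pos: "\<And>x. 0 < f0 x" and f1_pos: "\<And>x. 0 < f1 x"
    and prob_f0: "prob_space (density M f0)"
    and prob_f1: "prob_space (density M f1)"
begin

definition mix :: "'a \<Rightarrow> real" where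
  "mix x = (1 - p) * f0 x + p * f1 x"

abbreviation \<mu> :: "'a measure" where "\<mu> \<equiv> density M (\<lambda>x. ennreal (mix x))"
abbreviation \<mu>0 :: "'a measure" where "\<mu>0 \<equiv> density M (\<lambda>x. ennreal (f0 x))"
abbreviation \<mu>1 :: "'a measure" where "\<mu>1 \<equiv> density M (\<lambda>x. ennreal (f1 x))"

lemma mix_measurable [measurable]: "mix \<in> borel_measurable M"
  unfolding mix_def[abs_def] by measurable

lemma mix_pos: "0 < mix x"
  unfolding mix_def using p_pos p_less f0_pos f1_pos by (intro add_pos_pos mult_pos_pos) auto

text \<open>Stated for nonnegative integrals so that transport estimates can be applied to costs
  that may be infinite.\<close>

lemma nn_integral_mix:
  assumes [measurable]: "h \<in> borel_measurable M"
  shows "(\<integral>\<^sup>+x. h x \<partial>\<mu>) = ennreal (1 - p) * (\<integral>\<^sup>+x. h x \<partial>\<mu>0) + ennreal p * (\<integral>\<^sup>+x. h x \<partial>\<mu>1)"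
proof -
  have "(\<integral>\<^sup>+x. h x \<partial>\<mu>) = (\<integral>\<^sup>+x. ennreal (1 - p) * (ennreal (f0 x) * h x)
      + ennreal p * (ennreal (f1 x) * h x) \<partial>M)"
  proof -
    have "ennreal (mix x) = ennreal (1 - p) * ennreal (f0 x) + ennreal p * ennreal (f1 x)" for x
      using p_pos p_less f0_pos[of x] f1_pos[of x]
      by (simp add: mix_def ennreal_plus ennreal_mult less_imp_le)
    then show ?thesis
      by (simp add: nn_integral_density distrib_right mult.assoc)
  qed
  then show ?thesis
    by (simp add: nn_integral_add nn_integral_cmult nn_integral_density)
qed

lemma prob_space_mix: "prob_space \<mu>"
proof
  have "emeasure \<mu>0 (space M) = 1" "emeasure \<mu>1 (space M) = 1"
    using prob_space.emeasure_space_1[OF prob_f0] prob_space.emeasure_space_1[OF prob_f1] by auto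
  then show "emeasure \<mu> (space \<mu>) = 1"
    using nn_integral_mix[of "\<lambda>_. 1"] p_pos p_less
    by (simp flip: ennreal_plus)
qed

lemma has_bochner_integral_mix:
  fixes h :: "'a \<Rightarrow> real"
  assumes "has_bochner_integral \<mu>0 h a" "has_bochner_integral \<mu>1 h b"
  shows "has_bochner_integral \<mu> h ((1 - p) * a + p * b)"
proof -
  have [measurable]: "h \<in> borel_measurable M"
    using assms(1) by (auto dest: borel_measurable_has_bochner_integral)
  have "has_bochner_integral M (\<lambda>x. (1 - p) * (f0 x * h x) + p * (f1 x * h x)) ((1 - p) * a + p * b)"
    using assms f0_pos f1_pos
    by (intro has_bochner_integral_add has_bochner_integral_mult_right)
      (auto simp: has_bochner_integral_density_iff)
  then show ?thesis
    by (subst has_bochner_integral_density_iff) (auto simp: mix_pos, simp add: mix_def algebra_simps)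
qed

lemma integral_one: "has_bochner_integral M f0 1" "has_bochner_integral M f1 1"
proof -
  have 1: "has_bochner_integral \<mu>0 (\<lambda>_. 1::real) 1" "has_bochner_integral \<mu>1 (\<lambda>_. 1::real) 1"
    by (intro has_bochner_integral_prob_const prob_f0 prob_f1)+
  have iff: "has_bochner_integral (density M g) (\<lambda>_. 1 :: real) 1 \<longleftrightarrow> has_bochner_integral M g 1"
    if "g \<in> borel_measurable M" "\<And>x. 0 < g x" for g :: "'a \<Rightarrow> real"
    using has_bochner_integral_density_iff[of "\<lambda>_. 1" M g 1] that by simp
  show "has_bochner_integral M f0 1" "has_bochner_integral M f1 1"
    using iff[OF f0_measurable f0_pos] iff[OF f1_measurable f1_pos] 1 by blast+
qed

text \<open>Both bounds on the entropy of a mixture hold pointwise for \<open>mix * ln mix\<close>: the lower one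
  is monotonicity of the logarithm, the upper one convexity of \<open>t ln t\<close>.\<close>

lemma mix_ln_mix_ge:
  "(1 - p) * (ln (1 - p) * f0 x + f0 x * ln (f0 x)) + p * (ln p * f1 x + f1 x * ln (f1 x))
    \<le> mix x * ln (mix x)"
proof -
  have "ln (1 - p) + ln (f0 x) \<le> ln (mix x)" "ln p + ln (f1 x) \<le> ln (mix x)"
    using p_pos p_less f0_pos[of x] f1_pos[of x] mix_pos[of x]
    by (auto simp: mix_def simp flip: ln_mult_pos)
  then have "(1 - p) * f0 x * (ln (1 - p) + ln (f0 x)) + p * f1 x * (ln p + ln (f1 x))
      \<le> (1 - p) * f0 x * ln (mix x) + p * f1 x * ln (mix x)"
    using p_pos p_less f0_pos[of x] f1_pos[of x]
    by (intro add_mono mult_left_mono) auto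
  then show ?thesis by (simp add: mix_def algebra_simps)
qed

lemma mix_ln_mix_le:
  "mix x * ln (mix x) \<le> (1 - p) * (f0 x * ln (f0 x)) + p * (f1 x * ln (f1 x))"
proof -
  \<comment> \<open>Tangent line inequality \<open>ln t \<le> t - 1\<close> at
    \<open>t = mix x / g\<close>. In the weighted sum over \<open>g = f0 x\<close> and
    \<open>g = f1 x\<close> the linear corrections \<open>g - mix x\<close> cancel.\<close>
  have *: "g * ln (mix x) + g - mix x \<le> g * ln g" if "0 < g" for g
  proof -
    have "ln (mix x / g) \<le> mix x / g - 1"
      using that mix_pos[of x] by (intro ln_le_minus_one) auto
    then have "g * (ln (mix x) - ln g) \<le> g * (mix x / g - 1)"
      using that mix_pos[of x] by (intro mult_left_mono) (auto simp: ln_div)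
    then show ?thesis using that by (simp add: algebra_simps)
  qed
  have "(1 - p) * (f0 x * ln (mix x) + f0 x - mix x) + p * (f1 x * ln (mix x) + f1 x - mix x)
     \<le> (1 - p) * (f0 x * ln (f0 x)) + p * (f1 x * ln (f1 x))"
    using p_pos p_less f0_pos[of x] f1_pos[of x] *
    by (intro add_mono mult_left_mono) auto
  moreover have "(1 - p) * (f0 x * ln (mix x) + f0 x - mix x) + p * (f1 x * ln (mix x) + f1 x - mix x)
    = mix x * ln (mix x)"
    by (simp add: mix_def algebra_simps)
  ultimately show ?thesis by simp
qed

text \<open>Integrating the two pointwise bounds gives everything: a measurable function squeezed
  between integrable ones is integrable. The two estimates differ by exactly the Shannon entropy of
  the weights.\<close>

lemma entropy_mix:
  assumes a: "has_bochner_integral \<mu>0 (\<lambda>x. ln (f0 x)) a"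
    and b: "has_bochner_integral \<mu>1 (\<lambda>x. ln (f1 x)) b"
  shows "integrable \<mu> (\<lambda>x. ln (mix x))"
    and "(1 - p) * (ln (1 - p) + a) + p * (ln p + b) \<le> (\<integral>x. ln (mix x) \<partial>\<mu>)"
    and "(\<integral>x. ln (mix x) \<partial>\<mu>) \<le> (1 - p) * a + p * b"
proof -
  let ?u = "\<lambda>x. mix x * ln (mix x)"
  let ?L = "\<lambda>x. (1 - p) * (ln (1 - p) * f0 x + f0 x * ln (f0 x)) + p * (ln p * f1 x + f1 x * ln (f1 x))"
  let ?U = "\<lambda>x. (1 - p) * (f0 x * ln (f0 x)) + p * (f1 x * ln (f1 x))"
  have ab: "has_bochner_integral M (\<lambda>x. f0 x * ln (f0 x)) a" "has_bochner_integral M (\<lambda>x. f1 x * ln (f1 x)) b"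
    using a b f0_pos f1_pos by (auto simp: has_bochner_integral_density_iff)
  have L: "has_bochner_integral M ?L ((1 - p) * (ln (1 - p) * 1 + a) + p * (ln p * 1 + b))"
    by (intro has_bochner_integral_add has_bochner_integral_mult_right ab integral_one)
  have U: "has_bochner_integral M ?U ((1 - p) * a + p * b)"
    by (intro has_bochner_integral_add has_bochner_integral_mult_right ab)
  have u: "integrable M ?u"
  proof (rule Bochner_Integration.integrable_bound)
    show "integrable M (\<lambda>x. \<bar>?L x\<bar> + \<bar>?U x\<bar>)"
      by (intro Bochner_Integration.integrable_add integrable_abs integrable.intros[OF L] integrable.intros[OF U])
    show "AE x in M. norm (?u x) \<le> norm (\<bar>?L x\<bar> + \<bar>?U x\<bar>)"
    proof (rule AE_I2)
      fix x show "norm (?u x) \<le> norm (\<bar>?L x\<bar> + \<bar>?U x\<bar>)"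
        using mix_ln_mix_ge[of x] mix_ln_mix_le[of x] unfolding real_norm_def by linarith
    qed
  qed measurable
  then show "integrable \<mu> (\<lambda>x. ln (mix x))"
    by (subst integrable_density) (auto simp: mix_pos less_imp_le)
  have eq: "(\<integral>x. ln (mix x) \<partial>\<mu>) = integral\<^sup>L M ?u"
    by (subst integral_density) (auto simp: mix_pos less_imp_le)
  show "(1 - p) * (ln (1 - p) + a) + p * (ln p + b) \<le> (\<integral>x. ln (mix x) \<partial>\<mu>)"
    using integral_mono[OF integrable.intros[OF L] u mix_ln_mix_ge] has_bochner_integral_integral_eq[OF L] eq
    by simp
  show "(\<integral>x. ln (mix x) \<partial>\<mu>) \<le> (1 - p) * a + p * b"
    using integral_mono[OF u integrable.intros[OF U] mix_ln_mix_le] has_bochner_integral_integral_eq[OF U] eq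
    by simp
qed

text \<open>Jensen's inequality for the square, with weights proportional to
  \<open>(1 - p) * f0 x\<close> and \<open>p * f1 x\<close>; the gap is a nonnegative multiple of
  the square of \<open>b0 - b1\<close>.\<close>

lemma weighted_mean_square_le:
  "mix x * (((1 - p) * f0 x * b0 + p * f1 x * b1) / mix x)\<^sup>2
     \<le> (1 - p) * f0 x * b0\<^sup>2 + p * f1 x * b1\<^sup>2"
proof -
  define u v where "u = (1 - p) * f0 x" and "v = p * f1 x"
  have uv: "0 < u" "0 < v" "mix x = u + v"
    using p_pos p_less f0_pos[of x] f1_pos[of x] by (auto simp: u_def v_def mix_def)
  have "(u + v) * (u * b0\<^sup>2 + v * b1\<^sup>2) - (u * b0 + v * b1)\<^sup>2 = u * v * (b0 - b1)\<^sup>2"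
    by (simp add: power2_eq_square algebra_simps)
  moreover have "0 \<le> u * v * (b0 - b1)\<^sup>2" using uv by simp
  ultimately have "(u * b0 + v * b1)\<^sup>2 \<le> (u * b0\<^sup>2 + v * b1\<^sup>2) * (u + v)"
    by (simp add: mult.commute)
  then have "(u * b0 + v * b1)\<^sup>2 / (u + v) \<le> u * b0\<^sup>2 + v * b1\<^sup>2"
    using uv by (simp add: pos_divide_le_eq)
  moreover have "(u + v) * ((u * b0 + v * b1) / (u + v))\<^sup>2 = (u * b0 + v * b1)\<^sup>2 / (u + v)"
    using uv by (simp add: power2_eq_square)
  ultimately show ?thesis by (simp add: uv(3) flip: u_def v_def)
qed

text \<open>Convexity of the Fisher information in the situation where the log-gradients of the
  components are multiples \<open>b0\<close> and \<open>b1\<close> of one vector field with squared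
  length \<open>w\<close>. The log-gradient of the mixture is then a weighted mean of the multiples
  times that field. On the line \<open>w\<close> is 1; for scale mixtures it is the squared norm of
  the point.\<close>

lemma fisher_mix:
  assumes a: "has_bochner_integral \<mu>0 w a" and b: "has_bochner_integral \<mu>1 w b"
    and w: "\<And>x. 0 \<le> w x"
  shows "integrable \<mu> (\<lambda>x. (((1 - p) * f0 x * b0 + p * f1 x * b1) / mix x)\<^sup>2 * w x)" (is "integrable _ ?g")
    and "(\<integral>x. (((1 - p) * f0 x * b0 + p * f1 x * b1) / mix x)\<^sup>2 * w x \<partial>\<mu>)
      \<le> (1 - p) * (b0\<^sup>2 * a) + p * (b1\<^sup>2 * b)"
proof -
  have [measurable]: "w \<in> borel_measurable M"
    using a by (auto dest: borel_measurable_has_bochner_integral)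
  let ?U = "\<lambda>x. (1 - p) * (b0\<^sup>2 * (f0 x * w x)) + p * (b1\<^sup>2 * (f1 x * w x))"
  have U: "has_bochner_integral M ?U ((1 - p) * (b0\<^sup>2 * a) + p * (b1\<^sup>2 * b))"
    using a b f0_pos f1_pos
    by (intro has_bochner_integral_add has_bochner_integral_mult_right)
      (auto simp: has_bochner_integral_density_iff)
  have le: "mix x * ?g x \<le> ?U x" for x
    using mult_right_mono[OF weighted_mean_square_le[of x b0 b1] w[of x]] by (simp add: algebra_simps)
  have nn: "0 \<le> mix x * ?g x" for x
    using mix_pos[of x] w[of x] by simp
  have u: "integrable M (\<lambda>x. mix x * ?g x)"
  proof (rule Bochner_Integration.integrable_bound)
    show "integrable M ?U" by (rule integrable.intros[OF U])
    show "AE x in M. norm (mix x * ?g x) \<le> norm (?U x)"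
    proof (rule AE_I2)
      fix x show "norm (mix x * ?g x) \<le> norm (?U x)"
        using le[of x] nn[of x] unfolding real_norm_def by linarith
    qed
  qed measurable
  then show "integrable \<mu> ?g"
    by (subst integrable_density) (auto simp: mix_pos less_imp_le)
  have "integral\<^sup>L \<mu> ?g = integral\<^sup>L M (\<lambda>x. mix x * ?g x)"
    by (subst integral_density) (auto simp: mix_pos less_imp_le)
  also have "\<dots> \<le> integral\<^sup>L M ?U"
    by (intro integral_mono u le integrable.intros[OF U])
  finally show "integral\<^sup>L \<mu> ?g \<le> (1 - p) * (b0\<^sup>2 * a) + p * (b1\<^sup>2 * b)"
    using has_bochner_integral_integral_eq[OF U] by simp
qed

end

section \<open>Moments of Gaussian measures on the line\<close>

lemma has_bochner_integral_normal:
  assumes "0 < \<sigma>" "has_bochner_integral lborel (\<lambda>x. normal_density m \<sigma> x * h x) a"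
    and "h \<in> borel_measurable borel"
  shows "has_bochner_integral (density lborel (\<lambda>x. ennreal (normal_density m \<sigma> x))) h a"
  using assms by (intro has_bochner_integral_density) auto

lemma normal_mean:
  assumes "0 < \<sigma>"
  shows "has_bochner_integral (density lborel (\<lambda>x. ennreal (normal_density m \<sigma> x))) (\<lambda>x. x) m"
  using assms by (intro has_bochner_integral_normal normal_moment_nz_1) auto

text \<open>The centre \<open>c\<close> is arbitrary because distances are measured from the mean of
  the competing Gaussian. The square is expanded around \<open>m\<close> and regrouped into known
  moments.\<close>

lemma normal_second_moment:
  assumes "0 < \<sigma>"
  shows "has_bochner_integral (density lborel (\<lambda>x. ennreal (normal_density m \<sigma> x)))
    (\<lambda>x. (x - c)\<^sup>2) (\<sigma>\<^sup>2 + (m - c)\<^sup>2)"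
proof -
  let ?n = "normal_density m \<sigma>"
  have "has_bochner_integral lborel (\<lambda>x. ?n x * (x - m)^2 + (2 * (m - c)) * (?n x * x)
      + ((m - c)\<^sup>2 - 2 * (m - c) * m) * ?n x)
    (\<sigma>\<^sup>2 + (2 * (m - c)) * m + ((m - c)\<^sup>2 - 2 * (m - c) * m) * 1)"
    using assms normal_moment_even[OF assms, of m 1]
    by (intro has_bochner_integral_add has_bochner_integral_mult_right normal_moment_nz_1)
      (auto simp: has_bochner_integral_iff)
  then show ?thesis
    using assms by (intro has_bochner_integral_normal)
      (auto simp: power2_eq_square algebra_simps)
qed

lemma normal_fourth_moment:
  assumes "0 < \<sigma>"
  shows "has_bochner_integral (density lborel (\<lambda>x. ennreal (normal_density m \<sigma> x)))
    (\<lambda>x. (x - m)^4) (3 * \<sigma>^4)"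
proof -
  have "has_bochner_integral lborel (\<lambda>x. normal_density m \<sigma> x * (x - m)^4) (3 * \<sigma>^4)"
    using normal_moment_even[OF assms, of m 2] assms
    by (simp add: fact_numeral power_divide field_simps)
  then show ?thesis
    using assms by (intro has_bochner_integral_normal) auto
qed

section \<open>Lower bounds on transport costs\<close>

text \<open>Monotonicity of the power \<open>1 / r\<close>. An infinite cost is a separate case,
  since \<open>enn2real\<close> would send it to 0.\<close>

lemma wasserstein_ge:
  assumes "\<And>\<pi>. \<pi> \<in> couplings M N \<Longrightarrow> ennreal L \<le> (\<integral>\<^sup>+ z. ennreal (d (fst z) (snd z) powr r) \<partial>\<pi>)"
    and "0 \<le> L" "0 < r"
  shows "ennreal (L powr (1 / r)) \<le> wasserstein d r M N"
proof -
  define c where "c = (INF \<pi>\<in>couplings M N. \<integral>\<^sup>+ z. ennreal (d (fst z) (snd z) powr r) \<partial>\<pi>)"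
  have L: "ennreal L \<le> c"
    unfolding c_def using assms(1) by (intro INF_greatest)
  show ?thesis
  proof (cases c)
    case (real y)
    then have "L \<le> enn2real c" using L assms(2) by simp
    then show ?thesis
      using assms real by (auto simp: wasserstein_def simp flip: c_def intro!: ennreal_leI powr_mono2)
  next
    case top
    then show ?thesis by (simp add: wasserstein_def flip: c_def)
  qed
qed

lemma couplings_sets: "\<pi> \<in> couplings M N \<Longrightarrow> sets \<pi> = sets (M \<Otimes>\<^sub>M N)"
  by (simp add: couplings_def)

lemma couplings_nn_integral:
  assumes \<pi>: "\<pi> \<in> couplings M N"
  shows "h \<in> borel_measurable M \<Longrightarrow> (\<integral>\<^sup>+z. h (fst z) \<partial>\<pi>) = (\<integral>\<^sup>+x. h x \<partial>M)"
    and "g \<in> borel_measurable N \<Longrightarrow> (\<integral>\<^sup>+z. g (snd z) \<partial>\<pi>) = (\<integral>\<^sup>+y. g y \<partial>N)"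
proof -
  note [measurable_cong] = couplings_sets[OF \<pi>]
  have M: "distr \<pi> M fst = M" and N: "distr \<pi> N snd = N"
    using \<pi> by (auto simp: couplings_def)
  show "(\<integral>\<^sup>+z. h (fst z) \<partial>\<pi>) = (\<integral>\<^sup>+x. h x \<partial>M)" if [measurable]: "h \<in> borel_measurable M"
    using nn_integral_distr[of fst \<pi> M h] M by simp
  show "(\<integral>\<^sup>+z. g (snd z) \<partial>\<pi>) = (\<integral>\<^sup>+y. g y \<partial>N)" if [measurable]: "g \<in> borel_measurable N"
    using nn_integral_distr[of snd \<pi> N g] N by simp
qed

section \<open>Two Gaussians on the line\<close>

lemma sets_gauss1 [simp, measurable_cong]: "sets (gauss1 m) = sets borel"
  by (simp add: gauss1_def)

lemma space_gauss1 [simp]: "space (gauss1 m) = UNIV"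
  by (simp add: gauss1_def)

lemma prob_space_gauss1: "prob_space (gauss1 m)"
  unfolding gauss1_def by (rule prob_space_normal_density) simp

lemma density_gauss1:
  assumes [measurable]: "g \<in> borel_measurable borel"
    and "\<And>x. 0 \<le> g x" "\<And>x. normal_density 0 1 x * g x = h x"
  shows "density (gauss1 0) (\<lambda>x. ennreal (g x)) = density lborel (\<lambda>x. ennreal (h x))"
  unfolding gauss1_def
  by (subst density_density_eq) (auto simp: assms simp flip: ennreal_mult intro!: density_cong)

text \<open>The Cameron-Martin density in dimension one, by completing the square in the
  exponent.\<close>

lemma density_gauss1_tilt:
  "density (gauss1 0) (\<lambda>x. ennreal (exp (a * x - a\<^sup>2 / 2))) = gauss1 a"
proof -
  have "density (gauss1 0) (\<lambda>x. ennreal (exp (a * x - a\<^sup>2 / 2)))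
      = density lborel (\<lambda>x. ennreal (normal_density a 1 x))"
  proof (rule density_gauss1)
    fix x :: real
    have "- x\<^sup>2 / 2 + (a * x - a\<^sup>2 / 2) = - (x - a)\<^sup>2 / 2"
      by (simp add: power2_eq_square field_simps)
    then show "normal_density 0 1 x * exp (a * x - a\<^sup>2 / 2) = normal_density a 1 x"
      by (simp add: normal_density_def flip: exp_add)
  qed auto
  then show ?thesis by (simp add: gauss1_def)
qed

text \<open>Jensen: the absolute value of the mean of \<open>x - m\<close> is at most the mean of
  its absolute value.\<close>

lemma nn_integral_abs_gauss1_ge: "ennreal \<bar>b - m\<bar> \<le> (\<integral>\<^sup>+x. ennreal \<bar>x - m\<bar> \<partial>gauss1 b)"
proof -
  have mean: "has_bochner_integral (gauss1 b) (\<lambda>x. x - m) (b - m)"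
    using has_bochner_integral_diff[OF normal_mean[of 1 b, folded gauss1_def]
      has_bochner_integral_prob_const[OF prob_space_gauss1]] by simp
  then have "\<bar>b - m\<bar> \<le> (\<integral>x. \<bar>x - m\<bar> \<partial>gauss1 b)"
    using integral_abs_bound[of "gauss1 b" "\<lambda>x. x - m"]
    by (simp add: has_bochner_integral_integral_eq[OF mean])
  then have "ennreal \<bar>b - m\<bar> \<le> ennreal (\<integral>x. \<bar>x - m\<bar> \<partial>gauss1 b)"
    by (rule ennreal_leI)
  also have "\<dots> = (\<integral>\<^sup>+x. ennreal \<bar>x - m\<bar> \<partial>gauss1 b)"
    using integrable_abs[OF integrable.intros[OF mean]]
    by (intro nn_integral_eq_integral[symmetric]) auto
  finally show ?thesis .
qed

lemma nn_integral_abs_gauss1_le: "(\<integral>\<^sup>+x. ennreal \<bar>x - m\<bar> \<partial>gauss1 m) \<le> 1"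
proof -
  have var: "has_bochner_integral (gauss1 m) (\<lambda>x. (x - m)\<^sup>2) 1"
    using normal_second_moment[of 1 m m] by (simp add: gauss1_def)
  have 1: "has_bochner_integral (gauss1 m) (\<lambda>x. 1::real) 1"
    by (intro has_bochner_integral_prob_const prob_space_gauss1)
  have "\<bar>x - m\<bar> \<le> (1 + (x - m)\<^sup>2) / 2" for x
  proof -
    have "0 \<le> (\<bar>x - m\<bar> - 1)\<^sup>2" by simp
    then show ?thesis by (simp add: power2_diff)
  qed
  then have "(\<integral>\<^sup>+x. ennreal \<bar>x - m\<bar> \<partial>gauss1 m) \<le> (\<integral>\<^sup>+x. ennreal ((1 + (x - m)\<^sup>2) / 2) \<partial>gauss1 m)"
    by (intro nn_integral_mono ennreal_leI) auto
  also have "\<dots> = ennreal ((1 + 1) / 2)"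
    using has_bochner_integral_divide[OF has_bochner_integral_add[OF 1 var], of 2]
    by (auto simp: has_bochner_integral_iff nn_integral_eq_integral)
  finally show ?thesis by simp
qed

text \<open>Subtracting the quotient from \<open>p * s^2\<close> leaves
  \<open>p * (1 - p) * s^2\<close> over the same denominator, which is at least
  \<open>2 * p * (1 - p) * s\<close>. With \<open>s\<close> the square root of the Gaussian tilt,
  this controls the loss of Fisher information under mixing by a term linear in
  \<open>s\<close>.\<close>

lemma square_over_sum_ge:
  fixes p s :: real
  assumes "0 < p" "p < 1" "0 < s"
  shows "p * s\<^sup>2 - s / 2 \<le> (p * s\<^sup>2)\<^sup>2 / ((1 - p) + p * s\<^sup>2)"
proof -
  have pos: "0 < (1 - p) + p * s\<^sup>2" using assms by (intro add_pos_pos) auto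
  \<comment> \<open>This is the lower bound on the denominator after completing the square in
    \<open>s\<close>.\<close>
  have "0 \<le> p * (s - (1 - p))\<^sup>2 + (1 - p) * (1 - p * (1 - p))"
    using assms by (intro add_nonneg_nonneg mult_nonneg_nonneg) (auto intro: mult_le_one)
  then have "0 \<le> (1 - p) + p * s\<^sup>2 - 2 * p * (1 - p) * s"
    by (simp add: power2_eq_square algebra_simps)
  then have "0 \<le> s * ((1 - p) + p * s\<^sup>2 - 2 * p * (1 - p) * s)"
    using assms by simp
  then have "(p * s\<^sup>2 - s / 2) * ((1 - p) + p * s\<^sup>2) \<le> (p * s\<^sup>2)\<^sup>2"
    by (simp add: power2_eq_square field_simps)
  then show ?thesis using pos by (simp add: pos_le_divide_eq)
qed

text \<open>Easy half of Kantorovich duality with the 1-Lipschitz test function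
  \<open>\<bar>x - m\<bar>\<close>: its mean is at least \<open>p * a\<close> under the mixture and
  at most 1 under the Gaussian, for every \<open>m\<close>.\<close>

lemma wasserstein_gaussian_mixture_ge:
  assumes "\<And>h. h \<in> borel_measurable borel \<Longrightarrow> (\<integral>\<^sup>+x. h x \<partial>\<mu>)
      = ennreal (1 - p) * (\<integral>\<^sup>+x. h x \<partial>gauss1 0) + ennreal p * (\<integral>\<^sup>+x. h x \<partial>gauss1 a)"
    and sets_\<mu> [measurable_cong]: "sets \<mu> = sets borel"
    and p: "0 < p" "p \<le> 1/2" and pa: "1 \<le> p * a"
  shows "ennreal (p * a - 1) \<le> wasserstein dist 1 \<mu> (gauss1 m)"
proof -
  have "ennreal (p * a - 1) \<le> (\<integral>\<^sup>+z. ennreal (dist (fst z) (snd z) powr 1) \<partial>\<pi>)"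
    if \<pi>: "\<pi> \<in> couplings \<mu> (gauss1 m)" for \<pi>
  proof -
    note [measurable_cong] = couplings_sets[OF \<pi>]
    let ?W = "\<integral>\<^sup>+z. ennreal (dist (fst z) (snd z) powr 1) \<partial>\<pi>"
    \<comment> \<open>Since \<open>p \<le> 1/2\<close>, the weight \<open>1 - p\<close> may be
      lowered to \<open>p\<close>; the triangle inequality then removes \<open>m\<close>.\<close>
    have "p * a \<le> (1 - p) * \<bar>0 - m\<bar> + p * \<bar>a - m\<bar>"
    proof -
      have "p * a \<le> p * (\<bar>0 - m\<bar> + \<bar>a - m\<bar>)" using p by (intro mult_left_mono) auto
      also have "\<dots> \<le> (1 - p) * \<bar>0 - m\<bar> + p * \<bar>a - m\<bar>"
        using p by (simp add: distrib_left mult_right_mono)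
      finally show ?thesis .
    qed
    then have "ennreal (p * a) \<le> ennreal ((1 - p) * \<bar>0 - m\<bar> + p * \<bar>a - m\<bar>)"
      by (rule ennreal_leI)
    also have "\<dots> = ennreal (1 - p) * ennreal \<bar>0 - m\<bar> + ennreal p * ennreal \<bar>a - m\<bar>"
      using p by (simp add: ennreal_plus ennreal_mult)
    also have "\<dots> \<le> ennreal (1 - p) * (\<integral>\<^sup>+x. ennreal \<bar>x - m\<bar> \<partial>gauss1 0)
        + ennreal p * (\<integral>\<^sup>+x. ennreal \<bar>x - m\<bar> \<partial>gauss1 a)"
      by (intro add_mono mult_left_mono nn_integral_abs_gauss1_ge) auto
    also have "\<dots> = (\<integral>\<^sup>+x. ennreal \<bar>x - m\<bar> \<partial>\<mu>)"
      by (rule assms(1)[symmetric]) auto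
    also have "\<dots> = (\<integral>\<^sup>+z. ennreal \<bar>fst z - m\<bar> \<partial>\<pi>)"
      by (rule couplings_nn_integral(1)[OF \<pi>, symmetric]) auto
    also have "\<dots> \<le> (\<integral>\<^sup>+z. ennreal (dist (fst z) (snd z) powr 1) + ennreal \<bar>snd z - m\<bar> \<partial>\<pi>)"
      by (intro nn_integral_mono) (auto simp: dist_real_def simp flip: ennreal_plus intro!: ennreal_leI)
    also have "\<dots> = ?W + (\<integral>\<^sup>+z. ennreal \<bar>snd z - m\<bar> \<partial>\<pi>)"
      by (intro nn_integral_add) auto
    also have "(\<integral>\<^sup>+z. ennreal \<bar>snd z - m\<bar> \<partial>\<pi>) = (\<integral>\<^sup>+x. ennreal \<bar>x - m\<bar> \<partial>gauss1 m)"
      by (rule couplings_nn_integral(2)[OF \<pi>]) auto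
    also have "?W + \<dots> \<le> ?W + 1"
      by (intro add_left_mono nn_integral_abs_gauss1_le)
    finally have "ennreal (p * a) - 1 \<le> ?W + 1 - 1"
      by (intro ennreal_minus_mono) auto
    then show ?thesis by (simp add: ennreal_minus flip: ennreal_1)
  qed
  then show ?thesis
    using wasserstein_ge[of \<mu> "gauss1 m" "p * a - 1" dist 1] pa by simp
qed

text \<open>Translates of the standard Gaussian have deficit zero: for mean \<open>a\<close> both
  half the Fisher information and the entropy equal \<open>a^2 / 2\<close>. Hence only the Shannon
  entropy of the weights survives in the upper bound.\<close>

lemma two_gaussians:
  fixes p a :: real
  assumes p: "0 < p" "p \<le> 1/2" and pa: "1 \<le> p * a"
  obtains \<mu> D where "prob_space \<mu>" "gauss_mixture2 \<mu>" "ls_deficit1 \<mu> D"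
    "D \<le> - ((1 - p) * ln (1 - p) + p * ln p)" "- (a\<^sup>2 * exp (- a\<^sup>2 / 8) / 4) \<le> D"
    "\<And>m. ennreal (p * a - 1) \<le> wasserstein dist 1 \<mu> (gauss1 m)"
proof -
  define f1 where "f1 x = exp (a * x - a\<^sup>2 / 2)" for x :: real
  have f1_measurable [measurable]: "f1 \<in> borel_measurable borel"
    unfolding f1_def[abs_def] by measurable
  have tilt: "density (gauss1 0) (\<lambda>x. ennreal (f1 x)) = gauss1 a"
    unfolding f1_def by (rule density_gauss1_tilt)
  have one: "density (gauss1 0) (\<lambda>x. ennreal 1) = gauss1 0"
    using density_1 by simp
  interpret density_mixture "gauss1 0" "\<lambda>_. 1" f1 p
  proof (rule density_mixture.intro)
    show "prob_space (density (gauss1 0) (\<lambda>x. ennreal 1))" "prob_space (density (gauss1 0) (\<lambda>x. ennreal (f1 x)))"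
      unfolding one tilt by (rule prob_space_gauss1)+
  qed (use p in \<open>auto simp: f1_def\<close>)
  have mix_deriv: "(mix has_real_derivative p * f1 x * a) (at x)" for x
    unfolding mix_def[abs_def] f1_def
    by (auto intro!: derivative_eq_intros)
  \<comment> \<open>The vanishing summand is kept so that the score has the form of
    \<open>fisher_mix\<close> with slopes \<open>0\<close> and \<open>a\<close>.\<close>
  have d: "deriv (\<lambda>y. ln (mix y)) x = ((1 - p) * 1 * 0 + p * f1 x * a) / mix x" for x
    using mix_pos[of x] by (auto intro!: DERIV_imp_deriv derivative_eq_intros mix_deriv)
  have c0: "has_bochner_integral \<mu>0 (\<lambda>_. 1::real) 1" "has_bochner_integral \<mu>1 (\<lambda>_. 1::real) 1"
    using prob_f0 prob_f1 by (auto intro: has_bochner_integral_prob_const)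
  let ?g = "\<lambda>x. (((1 - p) * 1 * 0 + p * f1 x * a) / mix x)\<^sup>2 * 1"
  note fisher = fisher_mix[OF c0 zero_le_one, of 0 a]
  have e0: "has_bochner_integral \<mu>0 (\<lambda>x. ln 1) (0::real)"
    using has_bochner_integral_prob_const[OF prob_f0, of 0] by simp
  have e1: "has_bochner_integral \<mu>1 (\<lambda>x. ln (f1 x)) (a\<^sup>2 / 2)"
    using has_bochner_integral_diff[OF has_bochner_integral_mult_right[of a, OF normal_mean[of 1 a, folded gauss1_def]]
      has_bochner_integral_prob_const[OF prob_space_gauss1[of a], of "a\<^sup>2 / 2"]]
    unfolding tilt by (simp add: f1_def power2_eq_square)
  note ent = entropy_mix[OF e0 e1]
  define D where "D = (1/2) * (\<integral>x. (deriv (\<lambda>y. ln (mix y)) x)\<^sup>2 \<partial>\<mu>) - (\<integral>x. ln (mix x) \<partial>\<mu>)"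
  have Fe: "(\<integral>x. (deriv (\<lambda>y. ln (mix y)) x)\<^sup>2 \<partial>\<mu>) = (\<integral>x. ?g x \<partial>\<mu>)"
    unfolding d by simp
  show ?thesis
  proof
    show "prob_space \<mu>" by (rule prob_space_mix)
    have "\<mu> = density lborel (\<lambda>x. ennreal (p * normal_density a 1 x + (1 - p) * normal_density 0 1 x))"
    proof (rule density_gauss1)
      show "mix \<in> borel_measurable borel" using mix_measurable by simp
      fix x show "0 \<le> mix x" using mix_pos[of x] by simp
      have "- x\<^sup>2 / 2 + (a * x - a\<^sup>2 / 2) = - (x - a)\<^sup>2 / 2"
        by (simp add: power2_eq_square field_simps)
      then have "normal_density 0 1 x * f1 x = normal_density a 1 x"
        by (simp add: f1_def normal_density_def flip: exp_add)
      then show "normal_density 0 1 x * mix x = p * normal_density a 1 x + (1 - p) * normal_density 0 1 x"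
        by (simp add: mix_def algebra_simps)
    qed
    then show "gauss_mixture2 \<mu>"
      unfolding gauss_mixture2_def using p by (intro exI[of _ p] exI[of _ a] exI[of _ 0]) auto
    show "ls_deficit1 \<mu> D"
      unfolding ls_deficit1_def
    proof (intro exI[of _ mix] conjI allI)
      show "0 < mix x" for x by (rule mix_pos)
      show "mix differentiable (at x)" for x
        using mix_deriv real_differentiable_def by blast
      show "integrable \<mu> (\<lambda>x. (deriv (\<lambda>y. ln (mix y)) x)\<^sup>2)"
        unfolding d using fisher(1) by simp
    qed (use ent D_def in auto)
    show "D \<le> - ((1 - p) * ln (1 - p) + p * ln p)"
      using fisher(2) ent(2) by (simp add: D_def Fe algebra_simps)
    show "- (a\<^sup>2 * exp (- a\<^sup>2 / 8) / 4) \<le> D"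
    proof -
      \<comment> \<open>The square root of \<open>f1\<close> is \<open>exp (- a^2 / 8)\<close> times
        the density of \<open>gauss1 (a / 2)\<close>, so its integral, the Hellinger affinity of the
        two components, is exponentially small.\<close>
      have half: "has_bochner_integral (gauss1 0) (\<lambda>x. exp (a / 2 * x - (a / 2)\<^sup>2 / 2)) 1"
        using has_bochner_integral_prob_const[OF prob_space_gauss1[of "a/2"], of 1]
        unfolding density_gauss1_tilt[of "a / 2", symmetric]
        by (subst (asm) has_bochner_integral_density_iff) auto
      let ?L = "\<lambda>x. a\<^sup>2 * (p * f1 x - exp (- a\<^sup>2 / 8) / 2 * exp (a / 2 * x - (a / 2)\<^sup>2 / 2))"
      have L: "has_bochner_integral (gauss1 0) ?L (a\<^sup>2 * (p * 1 - exp (- a\<^sup>2 / 8) / 2 * 1))"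
        by (intro has_bochner_integral_diff has_bochner_integral_mult_right half integral_one)
      have le: "?L x \<le> mix x * ?g x" for x
      proof -
        define s where "s = exp (a / 2 * x - a\<^sup>2 / 4)"
        have "f1 x = s\<^sup>2" "exp (- a\<^sup>2 / 8) * exp (a / 2 * x - (a / 2)\<^sup>2 / 2) = s"
          by (simp_all add: s_def f1_def power2_eq_square algebra_simps flip: exp_add)
        moreover have "a\<^sup>2 * (p * s\<^sup>2 - s / 2) \<le> a\<^sup>2 * ((p * s\<^sup>2)\<^sup>2 / ((1 - p) + p * s\<^sup>2))"
          using p by (intro mult_left_mono square_over_sum_ge) (auto simp: s_def)
        ultimately show ?thesis
          using mix_pos[of x] by (simp add: mix_def power2_eq_square mult_ac)
      qed
      have "a\<^sup>2 * (p * 1 - exp (- a\<^sup>2 / 8) / 2 * 1) = integral\<^sup>L (gauss1 0) ?L"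
        by (rule has_bochner_integral_integral_eq[OF L, symmetric])
      also have "\<dots> \<le> (\<integral>x. mix x * ?g x \<partial>gauss1 0)"
      proof (intro integral_mono le integrable.intros[OF L])
        show "integrable (gauss1 0) (\<lambda>x. mix x * ?g x)"
          using fisher(1) by (subst (asm) integrable_density) (auto simp: mix_pos less_imp_le)
      qed
      also have "\<dots> = integral\<^sup>L \<mu> ?g"
        by (subst integral_density) (auto simp: mix_pos less_imp_le)
      \<comment> \<open>Half of the Fisher bound contributes \<open>p * a^2 / 2\<close>, which
        cancels against the upper bound for the entropy.\<close>
      finally show ?thesis
        using ent(3) by (simp add: D_def Fe algebra_simps)
    qed
    show "ennreal (p * a - 1) \<le> wasserstein dist 1 \<mu> (gauss1 m)" for m
    proof (rule wasserstein_gaussian_mixture_ge)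
      show "(\<integral>\<^sup>+x. h x \<partial>\<mu>) = ennreal (1 - p) * (\<integral>\<^sup>+x. h x \<partial>gauss1 0) + ennreal p * (\<integral>\<^sup>+x. h x \<partial>gauss1 a)"
        if "h \<in> borel_measurable borel" for h
        using nn_integral_mix[of h] that unfolding one tilt by simp
    qed (use p pa in auto)
  qed
qed

lemma mixtures_far_from_gaussians:
  "\<exists>(\<mu> :: nat \<Rightarrow> real measure) (D :: nat \<Rightarrow> real).
     (\<forall>k. prob_space (\<mu> k) \<and> gauss_mixture2 (\<mu> k) \<and> ls_deficit1 (\<mu> k) (D k)) \<and>
     D \<longlonglongrightarrow> 0 \<and>
     ((\<lambda>k. INF m. wasserstein dist 1 (\<mu> k) (gauss1 m)) \<longlongrightarrow> \<infinity>) sequentially"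
proof -
  \<comment> \<open>The shift by 2 gives \<open>p k \<le> 1/2\<close> from the start; the weight
    tends to 0 while \<open>p k * a k\<close> diverges.\<close>
  define p a where "p k = 1 / (real k + 2)" and "a k = (real k + 2)\<^sup>2" for k
  have pa: "p k * a k = real k + 2" for k
    by (simp add: p_def a_def power2_eq_square)
  have "\<exists>\<mu> D. prob_space \<mu> \<and> gauss_mixture2 \<mu> \<and> ls_deficit1 \<mu> D \<and>
      D \<le> - ((1 - p k) * ln (1 - p k) + p k * ln (p k)) \<and> - ((a k)\<^sup>2 * exp (- (a k)\<^sup>2 / 8) / 4) \<le> D \<and>
      (\<forall>m. ennreal (real k + 1) \<le> wasserstein dist 1 \<mu> (gauss1 m))" for k
  proof (rule two_gaussians[of "p k" "a k"])
    show "0 < p k" "p k \<le> 1 / 2" "1 \<le> p k * a k" unfolding pa by (auto simp: p_def)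
    have "p k * a k - 1 = real k + 1" by (simp add: pa)
    then show ?thesis
      if "prob_space \<mu>" "gauss_mixture2 \<mu>" "ls_deficit1 \<mu> D"
        "D \<le> - ((1 - p k) * ln (1 - p k) + p k * ln (p k))" "- ((a k)\<^sup>2 * exp (- (a k)\<^sup>2 / 8) / 4) \<le> D"
        "\<And>m. ennreal (p k * a k - 1) \<le> wasserstein dist 1 \<mu> (gauss1 m)" for \<mu> D
      using that by metis
  qed
  then obtain \<mu> D where *: "\<And>k. prob_space (\<mu> k) \<and> gauss_mixture2 (\<mu> k) \<and> ls_deficit1 (\<mu> k) (D k)"
    "\<And>k. D k \<le> - ((1 - p k) * ln (1 - p k) + p k * ln (p k))"
    "\<And>k. - ((a k)\<^sup>2 * exp (- (a k)\<^sup>2 / 8) / 4) \<le> D k"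
    "\<And>k m. ennreal (real k + 1) \<le> wasserstein dist 1 (\<mu> k) (gauss1 m)"
    by metis
  have "D \<longlonglongrightarrow> 0"
  proof (rule tendsto_sandwich)
    show "\<forall>\<^sub>F k in sequentially. - ((a k)\<^sup>2 * exp (- (a k)\<^sup>2 / 8) / 4) \<le> D k"
      "\<forall>\<^sub>F k in sequentially. D k \<le> - ((1 - p k) * ln (1 - p k) + p k * ln (p k))"
      using * by auto
    show "(\<lambda>k. - ((a k)\<^sup>2 * exp (- (a k)\<^sup>2 / 8) / 4)) \<longlonglongrightarrow> 0"
      unfolding a_def by real_asymp
    show "(\<lambda>k. - ((1 - p k) * ln (1 - p k) + p k * ln (p k))) \<longlonglongrightarrow> 0"
      unfolding p_def by real_asymp
  qed
  moreover have "((\<lambda>k. INF m. wasserstein dist 1 (\<mu> k) (gauss1 m)) \<longlongrightarrow> \<infinity>) sequentially"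
  proof (rule tendsto_sandwich)
    show "\<forall>\<^sub>F k in sequentially. ennreal (real k) \<le> (INF m. wasserstein dist 1 (\<mu> k) (gauss1 m))"
      using *(4) by (intro always_eventually allI INF_greatest)
        (metis ennreal_leI le_add_same_cancel1 order_trans zero_le_one)
    show "((\<lambda>k. ennreal (real k)) \<longlongrightarrow> \<infinity>) sequentially"
      using of_nat_tendsto_top_ennreal by (simp add: ennreal_of_nat_eq_real_of_nat)
  qed auto
  ultimately show ?thesis using *(1) by blast
qed

section \<open>Scale mixtures in high dimension\<close>

text \<open>A finite product measure is determined by measurable boxes, and over a box the integral
  of a product of one-variable functions factors.\<close>

lemma PiM_density:
  fixes M :: "'i \<Rightarrow> 'a measure" and g :: "'i \<Rightarrow> 'a \<Rightarrow> ennreal"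
  assumes "finite I" and M: "\<And>i. prob_space (M i)"
    and D: "\<And>i. prob_space (density (M i) (g i))"
    and g [measurable]: "\<And>i. g i \<in> borel_measurable (M i)"
  shows "density (PiM I M) (\<lambda>x. \<Prod>i\<in>I. g i (x i)) = PiM I (\<lambda>i. density (M i) (g i))"
proof -
  interpret M: product_sigma_finite M
    using M by (intro product_sigma_finite.intro prob_space_imp_sigma_finite)
  interpret D: product_sigma_finite "\<lambda>i. density (M i) (g i)"
    using D by (intro product_sigma_finite.intro prob_space_imp_sigma_finite)
  show ?thesis
  proof (rule D.PiM_eqI)
    show "sets (density (PiM I M) (\<lambda>x. \<Prod>i\<in>I. g i (x i))) = sets (PiM I (\<lambda>i. density (M i) (g i)))"
      by (simp cong: sets_PiM_cong)
    fix A assume "\<And>i. i \<in> I \<Longrightarrow> A i \<in> sets (density (M i) (g i))"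
    then have A [measurable]: "\<And>i. i \<in> I \<Longrightarrow> A i \<in> sets (M i)" by simp
    have "emeasure (density (PiM I M) (\<lambda>x. \<Prod>i\<in>I. g i (x i))) (Pi\<^sub>E I A)
        = (\<integral>\<^sup>+x. (\<Prod>i\<in>I. g i (x i)) * indicator (Pi\<^sub>E I A) x \<partial>PiM I M)"
      using assms(1) A by (intro emeasure_density sets_PiM_I_finite) auto
    also have "\<dots> = (\<integral>\<^sup>+x. (\<Prod>i\<in>I. g i (x i) * indicator (A i) (x i)) \<partial>PiM I M)"
    proof (rule nn_integral_cong)
      fix x assume "x \<in> space (PiM I M)"
      then have "indicator (Pi\<^sub>E I A) x = (\<Prod>i\<in>I. indicator (A i) (x i) :: ennreal)"
        using assms(1) by (auto simp: space_PiM PiE_iff indicator_def prod_zero_iff)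
      then show "(\<Prod>i\<in>I. g i (x i)) * indicator (Pi\<^sub>E I A) x = (\<Prod>i\<in>I. g i (x i) * indicator (A i) (x i))"
        by (simp add: prod.distrib)
    qed
    also have "\<dots> = (\<Prod>i\<in>I. \<integral>\<^sup>+t. g i t * indicator (A i) t \<partial>M i)"
      using assms(1) by (intro M.product_nn_integral_prod) auto
    also have "\<dots> = (\<Prod>i\<in>I. emeasure (density (M i) (g i)) (A i))"
      by (intro prod.cong refl) (auto simp: emeasure_density)
    finally show "emeasure (density (PiM I M) (\<lambda>x. \<Prod>i\<in>I. g i (x i))) (Pi\<^sub>E I A)
        = (\<Prod>i\<in>I. emeasure (density (M i) (g i)) (A i))" .
  qed fact
qed

lemma has_bochner_integral_PiM_component:
  fixes h :: "'a \<Rightarrow> real"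
  assumes M: "\<And>i. i \<in> I \<Longrightarrow> prob_space (M i)" and i: "i \<in> I"
    and h: "has_bochner_integral (M i) h a"
  shows "has_bochner_integral (PiM I M) (\<lambda>x. h (x i)) a"
proof -
  have [measurable]: "h \<in> borel_measurable (M i)"
    using h by (rule borel_measurable_has_bochner_integral)
  have d: "distr (PiM I M) (M i) (\<lambda>x. x i) = M i"
    using M i by (rule distr_PiM_component)
  have "integrable (PiM I M) (\<lambda>x. h (x i)) \<longleftrightarrow> integrable (M i) h"
    using integrable_distr_eq[of "\<lambda>x. x i" "PiM I M" "M i" h] i d by simp
  moreover have "(\<integral>x. h (x i) \<partial>PiM I M) = integral\<^sup>L (M i) h"
    using integral_distr[of "\<lambda>x. x i" "PiM I M" "M i" h] i d by simp
  ultimately show ?thesis using h by (simp add: has_bochner_integral_iff)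
qed

lemma has_bochner_integral_PiM_mult:
  fixes h k :: "'a \<Rightarrow> real"
  assumes M: "\<And>i. prob_space (M i)" and I: "finite I" "i \<in> I" "j \<in> I" "i \<noteq> j"
    and h: "has_bochner_integral (M i) h a" and k: "has_bochner_integral (M j) k b"
  shows "has_bochner_integral (PiM I M) (\<lambda>x. h (x i) * k (x j)) (a * b)"
proof -
  interpret product_sigma_finite M
    using M by (intro product_sigma_finite.intro prob_space_imp_sigma_finite)
  \<comment> \<open>Padding with the constant 1 in the other coordinates turns a function of two
    coordinates into a full product.\<close>
  define f where "f l t = (if l = i then h t else 1) * (if l = j then k t else 1)" for l t
  have f: "has_bochner_integral (M l) (f l) ((if l = i then a else 1) * (if l = j then b else 1))" for l
    using h k I(4) has_bochner_integral_prob_const[OF M, of l 1] by (auto simp: f_def[abs_def])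
  have eq: "(\<Prod>l\<in>I. f l (x l)) = h (x i) * k (x j)" for x
    using I by (simp add: f_def prod.distrib)
  have "integrable (PiM I M) (\<lambda>x. \<Prod>l\<in>I. f l (x l))"
    using I(1) f by (intro product_integrable_prod) (auto simp: has_bochner_integral_iff)
  moreover have "(\<integral>x. (\<Prod>l\<in>I. f l (x l)) \<partial>PiM I M) = (\<Prod>l\<in>I. integral\<^sup>L (M l) (f l))"
    using I(1) f by (intro product_integral_prod) (auto simp: has_bochner_integral_iff)
  moreover have "\<dots> = a * b"
    using I has_bochner_integral_integral_eq[OF f] by (simp add: prod.distrib)
  ultimately show ?thesis
    unfolding eq by (simp add: has_bochner_integral_iff)
qed

section \<open>Centred Gaussians with covariance a multiple of the identity\<close>

definition centred_normal :: "real \<Rightarrow> real measure" where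
  "centred_normal \<sigma> = density lborel (\<lambda>x. ennreal (normal_density 0 \<sigma> x))"

lemma prob_space_centred_normal: "0 < \<sigma> \<Longrightarrow> prob_space (centred_normal \<sigma>)"
  unfolding centred_normal_def by (rule prob_space_normal_density)

lemma sets_centred_normal [simp, measurable_cong]: "sets (centred_normal \<sigma>) = sets borel"
  by (simp add: centred_normal_def)

definition centred_normal_n :: "nat \<Rightarrow> real \<Rightarrow> (nat \<Rightarrow> real) measure" where
  "centred_normal_n n \<sigma> = PiM {..<n} (\<lambda>_. centred_normal \<sigma>)"

lemma sets_gaussn [measurable_cong]: "sets (gaussn n m) = sets (PiM {..<n} (\<lambda>_. borel))"
  unfolding gaussn_def by (intro sets_PiM_cong) auto

lemma sets_centred_normal_n [measurable_cong]:
  "sets (centred_normal_n n \<sigma>) = sets (PiM {..<n} (\<lambda>_. borel))"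
  unfolding centred_normal_n_def by (intro sets_PiM_cong) auto

lemma prob_space_centred_normal_n: "0 < \<sigma> \<Longrightarrow> prob_space (centred_normal_n n \<sigma>)"
  unfolding centred_normal_n_def by (intro prob_space_PiM prob_space_centred_normal)

text \<open>Relative density with respect to the standard Gaussian of the centred Gaussian with
  standard deviation \<open>\<sigma>\<close> in each coordinate.\<close>

definition normal_ratio :: "nat \<Rightarrow> real \<Rightarrow> (nat \<Rightarrow> real) \<Rightarrow> real" where
  "normal_ratio n \<sigma> x = exp ((1 - 1 / \<sigma>\<^sup>2) / 2 * (\<Sum>i<n. (x i)\<^sup>2)) / \<sigma> ^ n"

lemma normal_ratio_pos: "0 < \<sigma> \<Longrightarrow> 0 < normal_ratio n \<sigma> x"
  by (simp add: normal_ratio_def)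

lemma normal_ratio_measurable [measurable]:
  "normal_ratio n \<sigma> \<in> borel_measurable (gaussn n m)"
  unfolding normal_ratio_def[abs_def] by measurable

lemma density_normal_ratio:
  assumes "0 < \<sigma>"
  shows "density (gaussn n (\<lambda>_. 0)) (\<lambda>x. ennreal (normal_ratio n \<sigma> x)) = centred_normal_n n \<sigma>"
proof -
  \<comment> \<open>The ratio in dimension one; \<open>normal_ratio\<close> is its product over the
    coordinates.\<close>
  define g where "g t = exp ((1 - 1 / \<sigma>\<^sup>2) / 2 * t\<^sup>2) / \<sigma>" for t :: real
  have g_measurable [measurable]: "g \<in> borel_measurable borel"
    unfolding g_def[abs_def] by measurable
  have g: "density (gauss1 0) (\<lambda>t. ennreal (g t)) = centred_normal \<sigma>"
    unfolding centred_normal_def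
  proof (rule density_gauss1)
    fix t show "0 \<le> g t" using assms by (simp add: g_def)
    have "- t\<^sup>2 / 2 + (1 - 1 / \<sigma>\<^sup>2) / 2 * t\<^sup>2 = - t\<^sup>2 / (2 * \<sigma>\<^sup>2)"
      using assms by (simp add: field_simps)
    then show "normal_density 0 1 t * g t = normal_density 0 \<sigma> t"
      using assms by (simp add: g_def normal_density_def real_sqrt_mult flip: exp_add)
  qed measurable
  have "ennreal (normal_ratio n \<sigma> x) = (\<Prod>i<n. ennreal (g (x i)))" for x
    using assms by (simp add: normal_ratio_def g_def prod_ennreal prod_dividef sum_distrib_left exp_sum)
  then have "density (gaussn n (\<lambda>_. 0)) (\<lambda>x. ennreal (normal_ratio n \<sigma> x))
      = density (PiM {..<n} (\<lambda>_. gauss1 0)) (\<lambda>x. \<Prod>i<n. ennreal (g (x i)))"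
    by (simp add: gaussn_def)
  also have "\<dots> = PiM {..<n} (\<lambda>_. density (gauss1 0) (\<lambda>t. ennreal (g t)))"
    using assms by (intro PiM_density) (auto simp: prob_space_gauss1 g prob_space_centred_normal)
  finally show ?thesis by (simp add: g centred_normal_n_def)
qed

lemma centred_normal_n_component:
  assumes "0 < \<sigma>" "i < n" "has_bochner_integral (centred_normal \<sigma>) h a"
  shows "has_bochner_integral (centred_normal_n n \<sigma>) (\<lambda>x. h (x i)) (a :: real)"
  unfolding centred_normal_n_def using assms
  by (intro has_bochner_integral_PiM_component prob_space_centred_normal) auto

lemma centred_normal_n_norm_sq:
  assumes "0 < \<sigma>"
  shows "has_bochner_integral (centred_normal_n n \<sigma>) (\<lambda>x. \<Sum>i<n. (x i)\<^sup>2) (real n * \<sigma>\<^sup>2)"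
proof -
  have "has_bochner_integral (centred_normal_n n \<sigma>) (\<lambda>x. \<Sum>i<n. (x i)\<^sup>2) (\<Sum>i<n. \<sigma>\<^sup>2)"
    using normal_second_moment[OF assms, of 0 0] assms
    by (intro has_bochner_integral_sum centred_normal_n_component) (auto simp: centred_normal_def)
  then show ?thesis by simp
qed

text \<open>The logarithm of the ratio is affine in the squared norm, so the second moment
  determines its integral.\<close>

lemma centred_normal_n_entropy:
  assumes "0 < \<sigma>"
  shows "has_bochner_integral (centred_normal_n n \<sigma>) (\<lambda>x. ln (normal_ratio n \<sigma> x))
    (real n * ((\<sigma>\<^sup>2 - 1) / 2 - ln \<sigma>))"
proof -
  have "has_bochner_integral (centred_normal_n n \<sigma>)
      (\<lambda>x. (1 - 1 / \<sigma>\<^sup>2) / 2 * (\<Sum>i<n. (x i)\<^sup>2) - real n * ln \<sigma>)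
      ((1 - 1 / \<sigma>\<^sup>2) / 2 * (real n * \<sigma>\<^sup>2) - real n * ln \<sigma>)"
    by (intro has_bochner_integral_diff has_bochner_integral_mult_right centred_normal_n_norm_sq assms
      has_bochner_integral_prob_const prob_space_centred_normal_n)
  moreover have "(1 - 1 / \<sigma>\<^sup>2) / 2 * (real n * \<sigma>\<^sup>2) - real n * ln \<sigma> = real n * ((\<sigma>\<^sup>2 - 1) / 2 - ln \<sigma>)"
    using assms by (simp add: field_simps)
  ultimately show ?thesis
    using assms by (simp add: normal_ratio_def ln_div ln_realpow)
qed

text \<open>The log-gradient at \<open>x\<close> is a constant multiple of \<open>x\<close>, which
  supplies the common vector field for \<open>fisher_mix\<close>.\<close>

lemma DERIV_normal_ratio:
  assumes "i < n"
  shows "((\<lambda>t. normal_ratio n \<sigma> (x(i := t))) has_real_derivative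
    normal_ratio n \<sigma> x * ((1 - 1 / \<sigma>\<^sup>2) * x i)) (at (x i))"
proof -
  have eq: "(\<Sum>j<n. ((x(i := t)) j)\<^sup>2) = t\<^sup>2 + (\<Sum>j\<in>{..<n} - {i}. (x j)\<^sup>2)" for t
    using assms by (subst sum.remove[of _ i]) auto
  have x: "(\<Sum>j<n. (x j)\<^sup>2) = (x i)\<^sup>2 + (\<Sum>j\<in>{..<n} - {i}. (x j)\<^sup>2)"
    using eq[of "x i"] by simp
  have deriv: "((\<lambda>t. exp (c * (t\<^sup>2 + C)) / d) has_real_derivative exp (c * (y\<^sup>2 + C)) / d * (2 * c * y)) (at y)"
    for c C d y :: real
    by (rule DERIV_cdivide[THEN DERIV_cong]) (auto intro!: derivative_eq_intros)
  define b where "b = 1 - 1 / \<sigma>\<^sup>2"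
  from deriv[of "b / 2" "\<Sum>j\<in>{..<n} - {i}. (x j)\<^sup>2" "\<sigma> ^ n" "x i"]
  show ?thesis
    unfolding normal_ratio_def eq x b_def[symmetric] by (rule DERIV_cong) simp
qed

text \<open>Weak Kantorovich duality for the quadratic cost: a nonnegative potential in
  \<open>x\<close> is bounded by the cost plus a fourth-moment potential in \<open>y\<close>. Only
  the part of \<open>\<mu>\<close> coming from the wide component is kept, hence the one-sided
  hypothesis. The Gaussian side costs just \<open>3 * n / \<sigma>^2\<close>, whatever its
  mean.\<close>

lemma wasserstein_scale_mixture_ge:
  assumes \<mu>: "\<And>h. h \<in> borel_measurable (gaussn n (\<lambda>_. 0)) \<Longrightarrow>
      ennreal p * (\<integral>\<^sup>+x. h x \<partial>centred_normal_n n \<sigma>) \<le> (\<integral>\<^sup>+x. h x \<partial>\<mu>)"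
    and sets_\<mu>: "sets \<mu> = sets (gaussn n (\<lambda>_. 0))"
    and pos: "0 < p" "0 < \<sigma>"
  shows "ennreal (sqrt (real n * (p * \<sigma>\<^sup>2 / 4 - 3 / \<sigma>\<^sup>2))) \<le> wasserstein (euclid_dist n) 2 \<mu> (gaussn n m)"
proof -
  define L where "L = real n * (p * \<sigma>\<^sup>2 / 4 - 3 / \<sigma>\<^sup>2)"
  have [measurable_cong]: "sets \<mu> = sets (PiM {..<n} (\<lambda>_. borel))"
    using sets_\<mu> by (simp add: sets_gaussn)
  \<comment> \<open>\<open>?\<Phi>\<close> is the potential; \<open>?\<Psi>\<close> is its version
    without truncation, smaller but explicitly integrable. \<open>?R\<close> is the potential on the
    Gaussian side.\<close>
  let ?\<Psi> = "\<lambda>x. \<Sum>i<n. (x i - m i)\<^sup>2 / 2 - \<sigma>\<^sup>2 / 4"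
  let ?\<Phi> = "\<lambda>x. \<Sum>i<n. max 0 ((x i - m i)\<^sup>2 / 2 - \<sigma>\<^sup>2 / 4)"
  let ?R = "\<lambda>y. \<Sum>i<n. (y i - m i)^4 / \<sigma>\<^sup>2"
  have comp: "has_bochner_integral (centred_normal_n n \<sigma>) (\<lambda>x. (x i - m i)\<^sup>2 / 2 - \<sigma>\<^sup>2 / 4)
      ((\<sigma>\<^sup>2 + (0 - m i)\<^sup>2) / 2 - \<sigma>\<^sup>2 / 4)" if "i < n" for i
    using pos that
    by (intro has_bochner_integral_diff has_bochner_integral_divide has_bochner_integral_prob_const
      prob_space_centred_normal_n centred_normal_n_component[where h = "\<lambda>t. (t - m i)\<^sup>2"]
      normal_second_moment[of \<sigma> 0, folded centred_normal_def]) auto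
  have \<Psi>: "has_bochner_integral (centred_normal_n n \<sigma>) ?\<Psi> (\<Sum>i<n. (\<sigma>\<^sup>2 + (0 - m i)\<^sup>2) / 2 - \<sigma>\<^sup>2 / 4)"
    using comp by (intro has_bochner_integral_sum) auto
  have \<Phi>: "integrable (centred_normal_n n \<sigma>) ?\<Phi>"
    using integrable.intros[OF comp]
    by (intro Bochner_Integration.integrable_sum integrable_max) auto
  \<comment> \<open>A nonzero \<open>m i\<close> only raises the second moment, so the bound is
    uniform in \<open>m\<close>.\<close>
  have "real n * (\<sigma>\<^sup>2 / 4) = (\<Sum>i<n. \<sigma>\<^sup>2 / 4)" by simp
  also have "\<dots> \<le> (\<Sum>i<n. (\<sigma>\<^sup>2 + (0 - m i)\<^sup>2) / 2 - \<sigma>\<^sup>2 / 4)"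
    by (intro sum_mono) (simp add: field_simps)
  also have "\<dots> = integral\<^sup>L (centred_normal_n n \<sigma>) ?\<Psi>"
    using has_bochner_integral_integral_eq[OF \<Psi>] by (rule sym)
  also have "\<dots> \<le> integral\<^sup>L (centred_normal_n n \<sigma>) ?\<Phi>"
    by (intro integral_mono integrable.intros[OF \<Psi>] \<Phi> sum_mono) auto
  finally have "ennreal (real n * (\<sigma>\<^sup>2 / 4)) \<le> ennreal (integral\<^sup>L (centred_normal_n n \<sigma>) ?\<Phi>)"
    by (rule ennreal_leI)
  also have "\<dots> = (\<integral>\<^sup>+x. ennreal (?\<Phi> x) \<partial>centred_normal_n n \<sigma>)"
    by (intro nn_integral_eq_integral[symmetric] \<Phi>) (auto intro!: sum_nonneg)
  finally have \<Phi>_ge: "ennreal (real n * (\<sigma>\<^sup>2 / 4)) \<le> (\<integral>\<^sup>+x. ennreal (?\<Phi> x) \<partial>centred_normal_n n \<sigma>)" .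
  have "has_bochner_integral (gaussn n m) ?R (\<Sum>i<n. 3 / \<sigma>\<^sup>2)"
    unfolding gaussn_def
    using pos normal_fourth_moment[of 1, folded gauss1_def]
    by (intro has_bochner_integral_sum has_bochner_integral_divide has_bochner_integral_PiM_component
        [where h = "\<lambda>t. (t - m i)^4" for i]) (auto simp: prob_space_gauss1)
  then have R: "(\<integral>\<^sup>+y. ennreal (?R y) \<partial>gaussn n m) = ennreal (real n * 3 / \<sigma>\<^sup>2)"
    by (subst nn_integral_eq_integral) (auto simp: has_bochner_integral_iff intro!: sum_nonneg)
  text \<open>The lower bound is zero except far from \<open>c\<close>, so the narrow component of the mixture cannot
    make its integral negative; the fourth moment comes from AM-GM.\<close>
  have pointwise: "max 0 ((x - c)\<^sup>2 / 2 - \<sigma>\<^sup>2 / 4) \<le> (x - y)\<^sup>2 + (y - c)^4 / \<sigma>\<^sup>2" for x y c :: real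
  proof -
    have "0 \<le> (\<sigma> / 2 - (y - c)\<^sup>2 / \<sigma>)\<^sup>2" by simp
    moreover have "(\<sigma> / 2 - d\<^sup>2 / \<sigma>)\<^sup>2 = \<sigma>\<^sup>2 / 4 - d\<^sup>2 + d^4 / \<sigma>\<^sup>2" for d
      using pos by (simp add: power2_diff power_divide flip: power_mult)
    ultimately have "(y - c)\<^sup>2 \<le> \<sigma>\<^sup>2 / 4 + (y - c)^4 / \<sigma>\<^sup>2" by simp
    moreover have "0 \<le> ((x - y) - (y - c))\<^sup>2" by simp
    then have "(x - c)\<^sup>2 \<le> 2 * ((x - y)\<^sup>2 + (y - c)\<^sup>2)"
      by (simp add: power2_eq_square algebra_simps)
    ultimately show ?thesis by (auto simp: max_def)
  qed
  have "ennreal L \<le> (\<integral>\<^sup>+z. ennreal (euclid_dist n (fst z) (snd z) powr 2) \<partial>\<pi>)"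
    if \<pi>: "\<pi> \<in> couplings \<mu> (gaussn n m)" for \<pi>
  proof -
    note [measurable_cong] = couplings_sets[OF \<pi>]
    have dist: "euclid_dist n x y powr 2 = (\<Sum>i<n. (x i - y i)\<^sup>2)" for x y
      by (simp add: euclid_dist_def sum_nonneg)
    let ?W = "\<integral>\<^sup>+z. ennreal (euclid_dist n (fst z) (snd z) powr 2) \<partial>\<pi>"
    have "ennreal (p * (real n * (\<sigma>\<^sup>2 / 4))) = ennreal p * ennreal (real n * (\<sigma>\<^sup>2 / 4))"
      using pos by (intro ennreal_mult) auto
    also have "\<dots> \<le> ennreal p * (\<integral>\<^sup>+x. ennreal (?\<Phi> x) \<partial>centred_normal_n n \<sigma>)"
      by (intro mult_left_mono \<Phi>_ge) auto
    also have "\<dots> \<le> (\<integral>\<^sup>+x. ennreal (?\<Phi> x) \<partial>\<mu>)"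
      by (rule \<mu>) measurable
    also have "\<dots> = (\<integral>\<^sup>+z. ennreal (?\<Phi> (fst z)) \<partial>\<pi>)"
      by (rule couplings_nn_integral(1)[OF \<pi>, symmetric]) measurable
    also have "\<dots> \<le> (\<integral>\<^sup>+z. ennreal (\<Sum>i<n. (fst z i - snd z i)\<^sup>2) + ennreal (?R (snd z)) \<partial>\<pi>)"
    proof (rule nn_integral_mono)
      fix z
      have "?\<Phi> (fst z) \<le> (\<Sum>i<n. (fst z i - snd z i)\<^sup>2 + (snd z i - m i)^4 / \<sigma>\<^sup>2)"
        by (intro sum_mono pointwise)
      then show "ennreal (?\<Phi> (fst z)) \<le> ennreal (\<Sum>i<n. (fst z i - snd z i)\<^sup>2) + ennreal (?R (snd z))"
        by (subst ennreal_plus[symmetric]) (auto simp: sum.distrib intro!: ennreal_leI sum_nonneg)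
    qed
    also have "\<dots> = ?W + (\<integral>\<^sup>+z. ennreal (?R (snd z)) \<partial>\<pi>)"
      unfolding dist by (intro nn_integral_add) measurable
    also have "(\<integral>\<^sup>+z. ennreal (?R (snd z)) \<partial>\<pi>) = (\<integral>\<^sup>+y. ennreal (?R y) \<partial>gaussn n m)"
      by (rule couplings_nn_integral(2)[OF \<pi>]) measurable
    finally have "ennreal (p * (real n * (\<sigma>\<^sup>2 / 4))) - ennreal (real n * 3 / \<sigma>\<^sup>2)
        \<le> ?W + ennreal (real n * 3 / \<sigma>\<^sup>2) - ennreal (real n * 3 / \<sigma>\<^sup>2)"
      unfolding R by (intro ennreal_minus_mono) auto
    moreover have "L = p * (real n * (\<sigma>\<^sup>2 / 4)) - real n * 3 / \<sigma>\<^sup>2"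
      by (simp add: L_def algebra_simps)
    ultimately show ?thesis
      by (simp add: ennreal_minus)
  qed
  then have "ennreal (L powr (1 / 2)) \<le> wasserstein (euclid_dist n) 2 \<mu> (gaussn n m)" if "0 \<le> L"
    using that by (intro wasserstein_ge) auto
  then show ?thesis
    \<comment> \<open>For negative \<open>L\<close> the root is negative too, and
      \<open>ennreal\<close> truncates it to 0.\<close>
    by (cases "0 \<le> L") (auto simp: powr_half_sqrt ennreal_neg simp flip: L_def)
qed

text \<open>The bound on \<open>D\<close> averages the deficits of the components,
  \<open>n / 2 * (1 / \<sigma>^2 - 1 + 2 * ln \<sigma>)\<close> each, and adds the Shannon entropy
  of the weights. Off-diagonal covariances vanish because the coordinates are independent and
  centred within each component; \<open>unit_variance\<close> settles the diagonal.\<close>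

lemma scale_mixture:
  fixes n :: nat and p \<sigma>0 \<sigma>1 :: real
  assumes p: "0 < p" "p < 1" and \<sigma>: "0 < \<sigma>0" "0 < \<sigma>1"
    and unit_variance: "(1 - p) * \<sigma>0\<^sup>2 + p * \<sigma>1\<^sup>2 = 1"
  obtains \<mu> D where "isotropic n \<mu>" "ls_deficitn n \<mu> D"
    "D \<le> real n / 2 * ((1 - p) * (1 / \<sigma>0\<^sup>2 - 1 + 2 * ln \<sigma>0) + p * (1 / \<sigma>1\<^sup>2 - 1 + 2 * ln \<sigma>1))
      - ((1 - p) * ln (1 - p) + p * ln p)"
    "\<And>m. ennreal (sqrt (real n * (p * \<sigma>1\<^sup>2 / 4 - 3 / \<sigma>1\<^sup>2)))
      \<le> wasserstein (euclid_dist n) 2 \<mu> (gaussn n m)"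
proof -
  note ratio = density_normal_ratio[OF \<sigma>(1), of n] density_normal_ratio[OF \<sigma>(2), of n]
  interpret density_mixture "gaussn n (\<lambda>_. 0)" "normal_ratio n \<sigma>0" "normal_ratio n \<sigma>1" p
  proof (rule density_mixture.intro)
    show "prob_space (density (gaussn n (\<lambda>_. 0)) (\<lambda>x. ennreal (normal_ratio n \<sigma>0 x)))"
      "prob_space (density (gaussn n (\<lambda>_. 0)) (\<lambda>x. ennreal (normal_ratio n \<sigma>1 x)))"
      unfolding ratio using \<sigma> by (auto intro: prob_space_centred_normal_n)
  qed (use p \<sigma> in \<open>auto intro: normal_ratio_pos\<close>)
  have mix_integral: "has_bochner_integral \<mu> h ((1 - p) * a + p * b)"
    if "has_bochner_integral (centred_normal_n n \<sigma>0) h a" "has_bochner_integral (centred_normal_n n \<sigma>1) h b"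
    for h :: "(nat \<Rightarrow> real) \<Rightarrow> real" and a b
    using has_bochner_integral_mix[unfolded ratio] that by blast
  \<comment> \<open>The slopes of the two scores: component \<open>i\<close> has log-gradient
    \<open>c0 * x i\<close> or \<open>c1 * x i\<close> in direction \<open>i\<close>.\<close>
  define c0 c1 where "c0 = 1 - 1 / \<sigma>0\<^sup>2" and "c1 = 1 - 1 / \<sigma>1\<^sup>2"
  have mix_deriv: "((\<lambda>t. mix (x(i := t))) has_real_derivative
      (1 - p) * (normal_ratio n \<sigma>0 x * (c0 * x i)) + p * (normal_ratio n \<sigma>1 x * (c1 * x i))) (at (x i))"
    if "i < n" for x i
    unfolding mix_def c0_def c1_def
    by (intro DERIV_add DERIV_cmult DERIV_normal_ratio that)
  let ?w = "\<lambda>x :: nat \<Rightarrow> real. \<Sum>i<n. (x i)\<^sup>2"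
  let ?g = "\<lambda>x. (((1 - p) * normal_ratio n \<sigma>0 x * c0 + p * normal_ratio n \<sigma>1 x * c1) / mix x)\<^sup>2 * ?w x"
  have grad: "grad_sq n (\<lambda>y. ln (mix y)) = ?g"
  proof
    fix x
    have "deriv (\<lambda>t. ln (mix (x(i := t)))) (x i)
        = ((1 - p) * normal_ratio n \<sigma>0 x * c0 + p * normal_ratio n \<sigma>1 x * c1) / mix x * x i"
      if "i < n" for i
    proof (rule DERIV_imp_deriv)
      have "((\<lambda>t. ln (mix (x(i := t)))) has_real_derivative
          1 / mix (x(i := x i)) * ((1 - p) * (normal_ratio n \<sigma>0 x * (c0 * x i))
            + p * (normal_ratio n \<sigma>1 x * (c1 * x i)))) (at (x i))"
        by (rule DERIV_chain'[OF mix_deriv[OF that] DERIV_ln_divide]) (rule mix_pos)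
      then show "((\<lambda>t. ln (mix (x(i := t)))) has_real_derivative
          ((1 - p) * normal_ratio n \<sigma>0 x * c0 + p * normal_ratio n \<sigma>1 x * c1) / mix x * x i) (at (x i))"
        by (rule DERIV_cong) (simp add: field_simps)
    qed
    then show "grad_sq n (\<lambda>y. ln (mix y)) x = ?g x"
      by (simp add: grad_sq_def power_mult_distrib power_divide sum_distrib_left sum_divide_distrib)
  qed
  have w: "has_bochner_integral \<mu>0 ?w (real n * \<sigma>0\<^sup>2)" "has_bochner_integral \<mu>1 ?w (real n * \<sigma>1\<^sup>2)"
    unfolding ratio using \<sigma> by (auto intro: centred_normal_n_norm_sq)
  note fisher = fisher_mix[OF w, of c0 c1, OF sum_nonneg[OF zero_le_power2]]
  have l: "has_bochner_integral \<mu>0 (\<lambda>x. ln (normal_ratio n \<sigma>0 x)) (real n * ((\<sigma>0\<^sup>2 - 1) / 2 - ln \<sigma>0))"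
    "has_bochner_integral \<mu>1 (\<lambda>x. ln (normal_ratio n \<sigma>1 x)) (real n * ((\<sigma>1\<^sup>2 - 1) / 2 - ln \<sigma>1))"
    unfolding ratio using \<sigma> by (auto intro: centred_normal_n_entropy)
  note ent = entropy_mix[OF l]
  define D where "D = (1/2) * (\<integral>x. grad_sq n (\<lambda>y. ln (mix y)) x \<partial>\<mu>) - (\<integral>x. ln (mix x) \<partial>\<mu>)"
  show ?thesis
  proof
    have mean: "has_bochner_integral \<mu> (\<lambda>x. x i) ((1 - p) * 0 + p * 0)" if "i < n" for i
      using that \<sigma> normal_mean[of _ 0, folded centred_normal_def]
      by (intro mix_integral centred_normal_n_component) auto
    have second: "has_bochner_integral \<mu> (\<lambda>x. x i * x j) (if i = j then 1 else 0)"
      if ij: "i < n" "j < n" for i j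
    proof (cases "i = j")
      case True
      have "has_bochner_integral \<mu> (\<lambda>x. (x i - 0)\<^sup>2)
          ((1 - p) * (\<sigma>0\<^sup>2 + (0 - 0)\<^sup>2) + p * (\<sigma>1\<^sup>2 + (0 - 0)\<^sup>2))"
        using ij \<sigma>
        by (intro mix_integral centred_normal_n_component[where h = "\<lambda>t. (t - 0)\<^sup>2"]
          normal_second_moment[of _ 0, folded centred_normal_def]) auto
      then show ?thesis using True unit_variance by (simp add: power2_eq_square)
    next
      case False
      have "has_bochner_integral \<mu> (\<lambda>x. x i * x j) ((1 - p) * (0 * 0) + p * (0 * 0))"
        using ij False \<sigma> normal_mean[of _ 0, folded centred_normal_def]
        by (intro mix_integral; unfold centred_normal_n_def;
            intro has_bochner_integral_PiM_mult prob_space_centred_normal) auto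
      then show ?thesis using False by simp
    qed
    show "isotropic n \<mu>"
      unfolding isotropic_def
      using prob_space_mix mean second by (auto simp: has_bochner_integral_iff)
    show "ls_deficitn n \<mu> D"
      unfolding ls_deficitn_def
    proof (intro exI[of _ mix] conjI ballI allI impI)
      show "0 < mix x" for x by (rule mix_pos)
      show "(\<lambda>t. mix (x(i := t))) differentiable (at (x i))" if "i < n" for x i
        using mix_deriv[OF that] real_differentiable_def by blast
      show "integrable \<mu> (grad_sq n (\<lambda>y. ln (mix y)))"
        unfolding grad by (rule fisher(1))
    qed (use ent D_def in auto)
    \<comment> \<open>Fisher information of the centred Gaussian with standard deviation
      \<open>s\<close>, relative to the standard one.\<close>
    have sq: "(1 - 1 / s\<^sup>2)\<^sup>2 * (real n * s\<^sup>2) = real n * (s\<^sup>2 - 2 + 1 / s\<^sup>2)" if "0 < s" for s :: real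
      using that by (simp add: power2_eq_square field_simps)
    have "(\<integral>x. grad_sq n (\<lambda>y. ln (mix y)) x \<partial>\<mu>)
        \<le> (1 - p) * (real n * (\<sigma>0\<^sup>2 - 2 + 1 / \<sigma>0\<^sup>2)) + p * (real n * (\<sigma>1\<^sup>2 - 2 + 1 / \<sigma>1\<^sup>2))"
      using fisher(2) \<sigma> unfolding grad by (simp add: c0_def c1_def sq)
    then have "D \<le> (1/2) * ((1 - p) * (real n * (\<sigma>0\<^sup>2 - 2 + 1 / \<sigma>0\<^sup>2)) + p * (real n * (\<sigma>1\<^sup>2 - 2 + 1 / \<sigma>1\<^sup>2)))
      - ((1 - p) * (ln (1 - p) + real n * ((\<sigma>0\<^sup>2 - 1) / 2 - ln \<sigma>0))
        + p * (ln p + real n * ((\<sigma>1\<^sup>2 - 1) / 2 - ln \<sigma>1)))"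
      unfolding D_def using ent(2) by (intro diff_mono mult_left_mono) auto
    also have "\<dots> = real n / 2 * ((1 - p) * (1 / \<sigma>0\<^sup>2 - 1 + 2 * ln \<sigma>0) + p * (1 / \<sigma>1\<^sup>2 - 1 + 2 * ln \<sigma>1))
      - ((1 - p) * ln (1 - p) + p * ln p)"
      using \<sigma> by (simp add: field_simps)
    finally show "D \<le> real n / 2 * ((1 - p) * (1 / \<sigma>0\<^sup>2 - 1 + 2 * ln \<sigma>0) + p * (1 / \<sigma>1\<^sup>2 - 1 + 2 * ln \<sigma>1))
      - ((1 - p) * ln (1 - p) + p * ln p)" .
    show "ennreal (sqrt (real n * (p * \<sigma>1\<^sup>2 / 4 - 3 / \<sigma>1\<^sup>2)))
      \<le> wasserstein (euclid_dist n) 2 \<mu> (gaussn n m)" for m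
    proof (rule wasserstein_scale_mixture_ge)
      show "ennreal p * (\<integral>\<^sup>+x. h x \<partial>centred_normal_n n \<sigma>1) \<le> (\<integral>\<^sup>+x. h x \<partial>\<mu>)"
        if "h \<in> borel_measurable (gaussn n (\<lambda>_. 0))" for h
        using nn_integral_mix[OF that] unfolding ratio by simp
    qed (use p \<sigma> in auto)
  qed
qed

lemma isotropic_far_from_gaussians:
  "\<exists>(n :: nat \<Rightarrow> nat) (\<mu> :: nat \<Rightarrow> (nat \<Rightarrow> real) measure) (D :: nat \<Rightarrow> real).
     mono n \<and> filterlim n at_top sequentially \<and>
     (\<forall>k. isotropic (n k) (\<mu> k) \<and> ls_deficitn (n k) (\<mu> k) (D k)) \<and>
     (\<exists>C. \<forall>\<^sub>F k in sequentially. D k \<le> C * real (n k) powr (-1/3)) \<and>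
     (\<exists>c>0. \<forall>\<^sub>F k in sequentially.
        (INF m. wasserstein (euclid_dist (n k)) 2 (\<mu> k) (gaussn (n k) m))
          \<ge> ennreal (c * real (n k) powr (1/6)))"
proof -
  define n :: "nat \<Rightarrow> nat" where "n k = (k + 2) ^ 3" for k
  \<comment> \<open>With \<open>N = k + 2\<close>, \<open>v k\<close> is the variance of the narrow
    component, while \<open>\<sigma> k\<close> below is a standard deviation. As
    \<open>p k * (\<sigma> k)^2\<close> equals \<open>1 / N^2\<close>, isotropy forces this
    \<open>v k\<close>; \<open>N \<ge> 2\<close> keeps it positive.\<close>
  define p v where "p k = 1 / (real k + 2) ^ 6"
    and "v k = (1 - 1 / (real k + 2)\<^sup>2) / (1 - 1 / (real k + 2) ^ 6)" for k
  define \<sigma> where "\<sigma> k = (real k + 2)\<^sup>2" for k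
  define B where "B k = real (n k) / 2 * ((1 - p k) * (1 / (sqrt (v k))\<^sup>2 - 1 + 2 * ln (sqrt (v k)))
        + p k * (1 / (\<sigma> k)\<^sup>2 - 1 + 2 * ln (\<sigma> k)))
      - ((1 - p k) * ln (1 - p k) + p k * ln (p k))" for k
  define L where "L k = sqrt (real (n k) * (p k * (\<sigma> k)\<^sup>2 / 4 - 3 / (\<sigma> k)\<^sup>2))" for k
  have "\<exists>\<mu> D. isotropic (n k) \<mu> \<and> ls_deficitn (n k) \<mu> D \<and> D \<le> B k \<and>
      (\<forall>m. ennreal (L k) \<le> wasserstein (euclid_dist (n k)) 2 \<mu> (gaussn (n k) m))" for k
  proof (rule scale_mixture[of "p k" "sqrt (v k)" "\<sigma> k" "n k"])
    have N: "1 < (real k + 2)\<^sup>2" "1 < (real k + 2) ^ 6" by (auto intro: one_less_power)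
    then show p: "0 < p k" "p k < 1" by (auto simp: p_def)
    have v: "0 < v k" using N by (simp add: v_def)
    then show "0 < sqrt (v k)" "0 < \<sigma> k" by (auto simp: \<sigma>_def)
    have "(1 - p k) * v k = 1 - 1 / (real k + 2)\<^sup>2"
    proof -
      have "v k = (1 - 1 / (real k + 2)\<^sup>2) / (1 - p k)" by (simp add: v_def p_def)
      then show ?thesis using p by simp
    qed
    moreover have "p k * (\<sigma> k)\<^sup>2 = 1 / (real k + 2)\<^sup>2"
      by (simp add: p_def \<sigma>_def field_simps flip: power_mult power_add)
    ultimately show "(1 - p k) * (sqrt (v k))\<^sup>2 + p k * (\<sigma> k)\<^sup>2 = 1"
      using v by simp
    show ?thesis
      if "isotropic (n k) \<mu>" "ls_deficitn (n k) \<mu> D"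
        "D \<le> real (n k) / 2 * ((1 - p k) * (1 / (sqrt (v k))\<^sup>2 - 1 + 2 * ln (sqrt (v k)))
          + p k * (1 / (\<sigma> k)\<^sup>2 - 1 + 2 * ln (\<sigma> k))) - ((1 - p k) * ln (1 - p k) + p k * ln (p k))"
        "\<And>m. ennreal (sqrt (real (n k) * (p k * (\<sigma> k)\<^sup>2 / 4 - 3 / (\<sigma> k)\<^sup>2)))
          \<le> wasserstein (euclid_dist (n k)) 2 \<mu> (gaussn (n k) m)" for \<mu> D
      using that unfolding B_def L_def by blast
  qed
  then obtain \<mu> D where *: "\<And>k. isotropic (n k) (\<mu> k) \<and> ls_deficitn (n k) (\<mu> k) (D k)"
    "\<And>k. D k \<le> B k"
    "\<And>k m. ennreal (L k) \<le> wasserstein (euclid_dist (n k)) 2 (\<mu> k) (gaussn (n k) m)"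
    by metis
  have real_n: "real (n k) = (real k + 2) ^ 3" for k by (simp add: n_def add.commute)
  \<comment> \<open>The leading term is \<open>n * (1 - v)^2 / 4\<close>, about
    \<open>1 / (4 * N)\<close>; the wide component adds order \<open>ln N / N^3\<close> and the
    weights order \<open>ln N / N^6\<close>. The constant 1 therefore suffices eventually.\<close>
  have "\<forall>\<^sub>F k in sequentially. B k \<le> 1 * real (n k) powr (-1/3)"
    unfolding B_def real_n p_def v_def \<sigma>_def by real_asymp
  then have "\<forall>\<^sub>F k in sequentially. D k \<le> 1 * real (n k) powr (-1/3)"
    by eventually_elim (use *(2) order_trans in blast)
  \<comment> \<open>With \<open>x = k + 2\<close> the square of \<open>L k\<close> is
    \<open>x / 4 - 3 / x\<close>, while the square of the left side is \<open>x / 16\<close>; the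
    threshold 10 leaves ample room.\<close>
  moreover have "\<forall>\<^sub>F k in sequentially. 1/4 * real (n k) powr (1/6) \<le> L k"
    using eventually_ge_at_top[of 10]
  proof eventually_elim
    case (elim k)
    define x where "x = real k + 2"
    have x: "12 \<le> x" using elim by (simp add: x_def)
    have "48 / x \<le> 4" using x by (simp add: divide_le_eq)
    moreover have "x ^ 3 * (1 / x ^ 6 * (x\<^sup>2)\<^sup>2 / 4 - 3 / (x\<^sup>2)\<^sup>2) = x / 4 - 3 / x"
      using x by (simp add: field_simps power_numeral_reduce)
    moreover have "(x ^ 3) powr (1/6) = sqrt x"
      using x by (simp add: powr_powr powr_half_sqrt flip: powr_numeral)
    ultimately show ?case
      unfolding L_def real_n p_def \<sigma>_def x_def[symmetric]
      using x by (intro real_le_rsqrt) (simp add: power_mult_distrib power_divide)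
  qed
  then have "\<forall>\<^sub>F k in sequentially.
      ennreal (1/4 * real (n k) powr (1/6)) \<le> (INF m. wasserstein (euclid_dist (n k)) 2 (\<mu> k) (gaussn (n k) m))"
    by eventually_elim (rule INF_greatest, rule order_trans[OF ennreal_leI *(3)])
  moreover have "strict_mono n"
    unfolding n_def by (intro strict_monoI power_strict_mono) auto
  then have "mono n" "filterlim n at_top sequentially"
    by (auto intro: strict_mono_mono filterlim_subseq)
  ultimately show ?thesis
    using *(1) by (intro exI[of _ n] exI[of _ \<mu>] exI[of _ D] conjI exI[of _ "1::real"] exI[of _ "1/4::real"]) auto
qed

theorem theorem3:
  shows "(\<exists>(\<mu> :: nat \<Rightarrow> real measure) (D :: nat \<Rightarrow> real).
            (\<forall>k. prob_space (\<mu> k) \<and> gauss_mixture2 (\<mu> k) \<and> ls_deficit1 (\<mu> k) (D k)) \<and>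
            D \<longlonglongrightarrow> 0 \<and>
            ((\<lambda>k. INF m. wasserstein dist 1 (\<mu> k) (gauss1 m)) \<longlongrightarrow> \<infinity>) sequentially)
       \<and> (\<exists>(n :: nat \<Rightarrow> nat) (\<mu> :: nat \<Rightarrow> (nat \<Rightarrow> real) measure) (D :: nat \<Rightarrow> real).
            mono n \<and> filterlim n at_top sequentially \<and>
            (\<forall>k. isotropic (n k) (\<mu> k) \<and> ls_deficitn (n k) (\<mu> k) (D k)) \<and>
            (\<exists>C. \<forall>\<^sub>F k in sequentially. D k \<le> C * real (n k) powr (-1/3)) \<and>
            (\<exists>c>0. \<forall>\<^sub>F k in sequentially.
               (INF m. wasserstein (euclid_dist (n k)) 2 (\<mu> k) (gaussn (n k) m))
                 \<ge> ennreal (c * real (n k) powr (1/6))))"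
  using mixtures_far_from_gaussians isotropic_far_from_gaussians by (rule conjI)

end
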